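(* For every polynomial $p(x)$ and every $k\in\mathbb{N}$, $$\int_{\mathbb{Z}_p}\cdots\int_{\mathbb{Z}_p}\zeta^{\xi_1+\cdots+\xi_k}p(\xi_1+\cdots+\xi_k+x)\,d\mu_{-q}(\xi_1)\cdots d\mu_{-q}(\xi_k)=\left(\frac{[2]_q}{\zeta q e^{t}+1}\right)^{k}p(x).$$ In particular, for $n\ge 0$, $$E_{n,\zeta}^{(k)}(x\mid q)=\left(\frac{[2]_q}{\zeta qe^t+1}\right)^k x^n=\left(\int_{\mathbb{Z}_p}\cdots\int_{\mathbb{Z}_p}\zeta^{\xi_1+\cdots+\xi_k}e^{(\xi_1+\cdots+\xi_k)t}\,d\mu_{-q}(\xi_1)\cdots d\mu_{-q}(\xi_k)\right)x^n,$$ so $E_{n,\zeta}^{(k)}(x\mid q)$ is the Appell sequence for $\left(\frac{\zeta q e^t+1}{[2]_q}\right)^k$, i.e. it is Sheffer for $\left(\left(\frac{\zeta q e^t+1}{[2]_q}\right)^k,t\right)$.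
   Context: Let $p$ be an odd prime, $\mathbb{C}_p$ the completion of an algebraic closure of $\mathbb{Q}_p$, $q\in\mathbb{C}_p$ with $|q-1|_p<1$, $\zeta\in\mathbb{C}_p$ with $|1-\zeta|_p<1$, $[2]_q=1+q$ and $[x]_{-q}=\frac{1-(-q)^x}{1+q}$. For uniformly differentiable $f$ on $\mathbb{Z}_p$, $\int_{\mathbb{Z}_p}\zeta^{\xi}f(\xi)d\mu_{-q}(\xi)=\lim_{n\to\infty}\frac{1}{[p^n]_{-q}}\sum_{\xi=0}^{p^n-1}\zeta^\xi f(\xi)(-1)^\xi q^\xi$; integrals of exponentials are understood coefficientwise as formal power series in $t$. The weighted $q$-Euler polynomials of order $k$ are defined by $\left(\frac{[2]_q}{q\zeta e^t+1}\right)^k e^{xt}=\sum_{n\ge0}E_{n,\zeta}^{(k)}(x\mid q)\frac{t^n}{n!}$. Umbral calculus: a formal power series $h(t)=\sum_j a_jt^j/j!$ acts on polynomials as the operator $h(t)p(x)=\sum_j\frac{a_j}{j!}p^{(j)}(x)$ (so $e^{yt}p(x)=p(x+y)$) and as the linear functional with $\langle t^j\mid x^n\rangle=n!\delta_{n,j}$. For an invertible series $g(t)$ (nonzero constant term), the Appell sequence for $g(t)$ (Sheffer sequence for $(g(t),t)$) is the unique polynomial sequence $S_n$, $\deg S_n=n$, with $\langle g(t)t^j\mid S_n(x)\rangle=n!\delta_{n,j}$ for all $n,j\ge0$, equivalently $S_n(x)=g(t)^{-1}x^n$. *)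

theory Defs
  imports Complex_Main "HOL-Computational_Algebra.Computational_Algebra"
begin

section \<open>The field of p-adic complex numbers\<close>

text \<open>
  There is no library type of p-adic numbers, so the field is an arbitrary type of class
  \<^class>\<open>field_char_0\<close> with an absolute value \<open>nrm\<close>, required to be a completion of an
  algebraic closure of the p-adic numbers. This determines \<open>nrm\<close> and the field up to
  isometric isomorphism.
\<close>

definition nrm_lim :: "('a::field_char_0 \<Rightarrow> real) \<Rightarrow> (nat \<Rightarrow> 'a) \<Rightarrow> 'a \<Rightarrow> bool" where
  "nrm_lim nrm X L \<longleftrightarrow> (\<lambda>n. nrm (X n - L)) \<longlonglongrightarrow> 0"

definition nrm_Cauchy :: "('a::field_char_0 \<Rightarrow> real) \<Rightarrow> (nat \<Rightarrow> 'a) \<Rightarrow> bool" where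
  "nrm_Cauchy nrm X \<longleftrightarrow> (\<forall>e>0. \<exists>N. \<forall>m\<ge>N. \<forall>n\<ge>N. nrm (X m - X n) < e)"

text \<open>
  Inside a complete field whose absolute value extends the p-adic one, the completion of
  the rationals is their closure.
\<close>

definition padic_rats :: "('a::field_char_0 \<Rightarrow> real) \<Rightarrow> 'a set" where
  "padic_rats nrm = {x. \<exists>r :: nat \<Rightarrow> rat. nrm_lim nrm (\<lambda>n. of_rat (r n)) x}"

definition padic_ints :: "('a::field_char_0 \<Rightarrow> real) \<Rightarrow> 'a set" where
  "padic_ints nrm = {x \<in> padic_rats nrm. nrm x \<le> 1}"

definition padic_algebraic :: "('a::field_char_0 \<Rightarrow> real) \<Rightarrow> 'a set" where
  "padic_algebraic nrm =
     {x. \<exists>P. P \<noteq> 0 \<and> (\<forall>i. coeff P i \<in> padic_rats nrm) \<and> poly P x = 0}"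

locale padic_complex =
  fixes p :: nat and nrm :: "'a::field_char_0 \<Rightarrow> real"
  assumes prime_p: "prime p"
    and nrm_nonneg: "0 \<le> nrm x"
    and nrm_eq_0: "nrm x = 0 \<longleftrightarrow> x = 0"
    and nrm_mult: "nrm (x * y) = nrm x * nrm y"
    and nrm_ultra: "nrm (x + y) \<le> max (nrm x) (nrm y)"
    and nrm_of_int: "m \<noteq> 0 \<Longrightarrow> nrm (of_int m) = 1 / real p ^ multiplicity (int p) m"
    and complete: "nrm_Cauchy nrm X \<Longrightarrow> \<exists>L. nrm_lim nrm X L"
    and algebraic_closed:
      "degree P > 0 \<Longrightarrow> (\<And>i. coeff P i \<in> padic_algebraic nrm)
        \<Longrightarrow> \<exists>x \<in> padic_algebraic nrm. poly P x = 0"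
    and algebraic_dense: "e > 0 \<Longrightarrow> \<exists>y \<in> padic_algebraic nrm. nrm (x - y) < e"

text \<open>
  The power \<open>a\<close> to the \<open>z\<close> for a p-adic integer \<open>z\<close>, extending natural powers by continuity;
  meaningful for \<open>nrm (1 - a) < 1\<close>.
\<close>

definition padic_pow :: "('a::field_char_0 \<Rightarrow> real) \<Rightarrow> 'a \<Rightarrow> 'a \<Rightarrow> 'a" where
  "padic_pow nrm a z =
     (THE y. \<forall>m :: nat \<Rightarrow> nat. nrm_lim nrm (\<lambda>n. of_nat (m n)) z \<longrightarrow> nrm_lim nrm (\<lambda>n. a ^ m n) y)"


section \<open>Fermionic integrals over the p-adic integers\<close>

definition neg_q_bracket :: "'a::field_char_0 \<Rightarrow> nat \<Rightarrow> 'a" where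
  "neg_q_bracket q x = (1 - (- q) ^ x) / (1 + q)"

text \<open>
  Integrands are functions on the p-adic integers, represented by functions on the whole
  field; their values off \<^const>\<open>padic_ints\<close> are irrelevant.
\<close>

definition fermionic_sum :: "nat \<Rightarrow> 'a::field_char_0 \<Rightarrow> ('a \<Rightarrow> 'a) \<Rightarrow> nat \<Rightarrow> 'a" where
  "fermionic_sum p q f n =
     1 / neg_q_bracket q (p ^ n) * (\<Sum>\<xi><p ^ n. f (of_nat \<xi>) * (- 1) ^ \<xi> * q ^ \<xi>)"

definition fermionic_integrable ::
    "nat \<Rightarrow> ('a::field_char_0 \<Rightarrow> real) \<Rightarrow> 'a \<Rightarrow> ('a \<Rightarrow> 'a) \<Rightarrow> bool" where
  "fermionic_integrable p nrm q f \<longleftrightarrow> (\<exists>I. nrm_lim nrm (fermionic_sum p q f) I)"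

definition fermionic_integral ::
    "nat \<Rightarrow> ('a::field_char_0 \<Rightarrow> real) \<Rightarrow> 'a \<Rightarrow> ('a \<Rightarrow> 'a) \<Rightarrow> 'a" where
  "fermionic_integral p nrm q f = (THE I. nrm_lim nrm (fermionic_sum p q f) I)"

text \<open>
  Iterated integrals of a function of the list \<open>[\<xi>\<^sub>1, \<dots>, \<xi>\<^sub>k]\<close>, with \<open>\<xi>\<^sub>1\<close> innermost.
\<close>

primrec iter_integral ::
    "nat \<Rightarrow> ('a::field_char_0 \<Rightarrow> real) \<Rightarrow> 'a \<Rightarrow> nat \<Rightarrow> ('a list \<Rightarrow> 'a) \<Rightarrow> 'a" where
  "iter_integral p nrm q 0 F = F []"
| "iter_integral p nrm q (Suc k) F =
     fermionic_integral p nrm q (\<lambda>\<xi>. iter_integral p nrm q k (\<lambda>xs. F (xs @ [\<xi>])))"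

primrec iter_integrable ::
    "nat \<Rightarrow> ('a::field_char_0 \<Rightarrow> real) \<Rightarrow> 'a \<Rightarrow> nat \<Rightarrow> ('a list \<Rightarrow> 'a) \<Rightarrow> bool" where
  "iter_integrable p nrm q 0 F \<longleftrightarrow> True"
| "iter_integrable p nrm q (Suc k) F \<longleftrightarrow>
     (\<forall>\<xi> \<in> padic_ints nrm. iter_integrable p nrm q k (\<lambda>xs. F (xs @ [\<xi>]))) \<and>
     fermionic_integrable p nrm q (\<lambda>\<xi>. iter_integral p nrm q k (\<lambda>xs. F (xs @ [\<xi>])))"

text \<open>Integrals of power-series-valued functions are taken coefficientwise.\<close>

definition iter_integral_fps ::
    "nat \<Rightarrow> ('a::field_char_0 \<Rightarrow> real) \<Rightarrow> 'a \<Rightarrow> nat \<Rightarrow> ('a list \<Rightarrow> 'a fps) \<Rightarrow> 'a fps" where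
  "iter_integral_fps p nrm q k F =
     Abs_fps (\<lambda>n. iter_integral p nrm q k (\<lambda>xs. fps_nth (F xs) n))"

definition iter_integrable_fps ::
    "nat \<Rightarrow> ('a::field_char_0 \<Rightarrow> real) \<Rightarrow> 'a \<Rightarrow> nat \<Rightarrow> ('a list \<Rightarrow> 'a fps) \<Rightarrow> bool" where
  "iter_integrable_fps p nrm q k F \<longleftrightarrow>
     (\<forall>n. iter_integrable p nrm q k (\<lambda>xs. fps_nth (F xs) n))"


section \<open>Weighted q-Euler polynomials\<close>

text \<open>
  The generating function is a power series in \<open>t\<close> over the polynomial ring in \<open>x\<close>:
  \<open>fps_poly_const\<close> embeds series with constant coefficients, and \<open>exp_xt\<close> is \<open>e\<close> to the \<open>x t\<close>.
\<close>

definition fps_poly_const :: "'a::field_char_0 fps \<Rightarrow> 'a poly fps" where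
  "fps_poly_const h = Abs_fps (\<lambda>n. [:fps_nth h n:])"

definition exp_xt :: "'a::field_char_0 poly fps" where
  "exp_xt = Abs_fps (\<lambda>n. monom (1 / fact n) n)"

definition q_euler_poly :: "'a::field_char_0 \<Rightarrow> 'a \<Rightarrow> nat \<Rightarrow> nat \<Rightarrow> 'a poly" where
  "q_euler_poly q \<zeta> k n =
     smult (fact n)
       (fps_nth
         (fps_poly_const ((fps_const (1 + q) / (fps_const (q * \<zeta>) * fps_exp 1 + 1)) ^ k) * exp_xt) n)"


section \<open>Umbral calculus\<close>

text \<open>
  For a series with exponential coefficients \<open>a\<^sub>j\<close>, \<open>fps_nth h j\<close> is \<open>a\<^sub>j / j!\<close>; derivatives of
  order above the degree vanish, so the sums are finite.
\<close>

definition umbral_op :: "'a::field_char_0 fps \<Rightarrow> 'a poly \<Rightarrow> 'a poly" where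
  "umbral_op h P = (\<Sum>j\<le>degree P. smult (fps_nth h j) ((pderiv ^^ j) P))"

definition umbral_functional :: "'a::field_char_0 fps \<Rightarrow> 'a poly \<Rightarrow> 'a" where
  "umbral_functional h P = (\<Sum>n\<le>degree P. coeff P n * (fact n * fps_nth h n))"

definition sheffer_seq :: "'a::field_char_0 fps \<Rightarrow> 'a fps \<Rightarrow> (nat \<Rightarrow> 'a poly) \<Rightarrow> bool" where
  "sheffer_seq g f S \<longleftrightarrow>
     fps_nth g 0 \<noteq> 0 \<and> fps_nth f 0 = 0 \<and> fps_nth f 1 \<noteq> 0 \<and>
     (\<forall>n. degree (S n) = n) \<and>
     (\<forall>n j. umbral_functional (g * f ^ j) (S n) = (if n = j then fact n else 0))"

definition appell_seq :: "'a::field_char_0 fps \<Rightarrow> (nat \<Rightarrow> 'a poly) \<Rightarrow> bool" where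
  "appell_seq g S \<longleftrightarrow> sheffer_seq g fps_X S"

end

theory Submission imports Defs begin

text \<open>
  Put \<open>w = \<zeta> q\<close>, \<open>h(t) = (1 + q) / (w e\<^sup>t + 1)\<close> and \<open>Q = h(t) P\<close>, so that
  \<open>w Q(y + 1) + Q(y) = (1 + q) P(y)\<close>. The fermionic sums of \<open>\<zeta>\<^sup>\<xi> P(\<xi> + x)\<close> then telescope: with
  \<open>N = p\<^sup>n\<close>, which is odd, they equal \<open>(Q(x) + w\<^sup>N Q(x + N)) / (1 + q\<^sup>N)\<close>. Since \<open>w\<close> and
  \<open>q\<close> lie in the open unit disc around \<open>1\<close>, both \<open>w\<^sup>N\<close> and \<open>q\<^sup>N\<close> tend to \<open>1\<close>, and the integral is
  \<open>Q(x)\<close>. Iterating applies \<open>h(t)\<close> repeatedly.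
\<close>

section \<open>Umbral operators\<close>

text \<open>Raising the truncation only adds vanishing derivatives. A common bound lets polynomials
  of different degrees be handled term by term.\<close>

lemma umbral_op_eq_sum:
  assumes "degree P \<le> N"
  shows "umbral_op h P = (\<Sum>j\<le>N. smult (fps_nth h j) ((pderiv ^^ j) P))"
  unfolding umbral_op_def
proof (rule sum.mono_neutral_left)
  show "\<forall>j\<in>{..N} - {..degree P}. smult (fps_nth h j) ((pderiv ^^ j) P) = 0"
    by (auto intro!: poly_eqI simp: coeff_higher_pderiv coeff_eq_0)
qed (use assms in auto)

lemma umbral_op_add: "umbral_op h (P + R) = umbral_op h P + umbral_op h R"
proof -
  let ?N = "max (degree P) (degree R)"
  have "umbral_op h (P + R) = (\<Sum>j\<le>?N. smult (fps_nth h j) ((pderiv ^^ j) (P + R)))"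
    by (intro umbral_op_eq_sum degree_add_le_max)
  also have "\<dots> = umbral_op h P + umbral_op h R"
    by (simp add: umbral_op_eq_sum[of P ?N] umbral_op_eq_sum[of R ?N] higher_pderiv_add
        smult_add_right sum.distrib)
  finally show ?thesis .
qed

lemma smult_sum_right: "smult c (sum f A) = (\<Sum>i\<in>A. smult c (f i))"
  by (induction A rule: infinite_finite_induct) (simp_all add: smult_add_right)

lemma umbral_op_smult: "umbral_op h (smult c P) = smult c (umbral_op h P)"
  by (simp add: umbral_op_eq_sum[of "smult c P" "degree P"] umbral_op_def degree_smult_le
      higher_pderiv_smult smult_sum_right mult.commute)

lemma umbral_op_0: "umbral_op h 0 = 0"
  by (simp add: umbral_op_def)

lemma umbral_op_sum: "umbral_op h (sum f A) = (\<Sum>i\<in>A. umbral_op h (f i))"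
  by (induction A rule: infinite_finite_induct) (simp_all add: umbral_op_add umbral_op_0)

lemma coeff_umbral_op:
  "coeff (umbral_op h P) n =
     (\<Sum>j\<le>degree P. fps_nth h j * (pochhammer (of_nat (Suc n)) j * coeff P (n + j)))"
  by (simp add: umbral_op_def coeff_sum coeff_higher_pderiv)

text \<open>Only the term \<open>j = 0\<close> reaches the top coefficient, since derivatives lower
  the degree.\<close>

lemma degree_umbral_op:
  assumes "fps_nth h 0 \<noteq> 0"
  shows "degree (umbral_op h P) = degree P"
proof (cases "P = 0")
  case False
  have "coeff (umbral_op h P) (degree P) =
      (\<Sum>j\<le>degree P. if j = 0 then fps_nth h 0 * lead_coeff P else 0)"
    unfolding coeff_umbral_op by (intro sum.cong) (auto simp: coeff_eq_0)
  then have "coeff (umbral_op h P) (degree P) \<noteq> 0"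
    using assms False by simp
  then have "degree P \<le> degree (umbral_op h P)" by (rule le_degree)
  moreover have "degree (umbral_op h P) \<le> degree P"
    by (rule degree_le) (simp add: coeff_umbral_op coeff_eq_0)
  ultimately show ?thesis by simp
qed (simp add: umbral_op_0)

text \<open>At \<open>0\<close> the \<open>j\<close>-th derivative is \<open>j!\<close> times the
  \<open>j\<close>-th coefficient. The Sheffer conditions thus become statements about operators,
  where \<open>umbral_op_mult\<close> applies.\<close>

lemma umbral_functional_conv_op: "umbral_functional h P = poly (umbral_op h P) 0"
  by (simp add: poly_0_coeff_0 coeff_umbral_op umbral_functional_def pochhammer_fact[symmetric]
      mult_ac)

text \<open>The polynomials \<open>x\<^sup>n / n!\<close> turn umbral operators into convolutions of coefficients.\<close>

lemma higher_pderiv_divided_power: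
  "j \<le> n \<Longrightarrow> (pderiv ^^ j) (monom (1 / fact n) n) =
     (monom (1 / fact (n - j)) (n - j) :: 'a::field_char_0 poly)"
proof (induction j)
  case (Suc j)
  then have "n - j = Suc (n - Suc j)" by simp
  then show ?case using Suc by (simp add: pderiv_monom field_simps del: of_nat_Suc)
qed simp

lemma umbral_op_divided_power:
  "umbral_op h (monom (1 / fact n) n) =
     (\<Sum>j\<le>n. smult (fps_nth h j) (monom (1 / fact (n - j)) (n - j)))"
  by (simp add: umbral_op_def degree_monom_eq higher_pderiv_divided_power)

text \<open>The expansion into lower divided powers is the Cauchy product of \<open>h\<close> with
  \<open>e^(x t)\<close>.\<close>

lemma poly_umbral_op_divided_power:
  "poly (umbral_op h (monom (1 / fact n) n)) x = fps_nth (h * fps_exp x) n"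
  by (simp add: umbral_op_divided_power poly_sum poly_monom fps_mult_nth atLeast0AtMost)

lemma poly_divided_power_sum:
  fixes P :: "'a::field_char_0 poly"
  shows "P = (\<Sum>n\<le>degree P. smult (fact n * coeff P n) (monom (1 / fact n) n))"
  by (simp add: smult_monom poly_as_sum_of_monoms)

lemma poly_umbral_op:
  "poly (umbral_op h P) x = (\<Sum>n\<le>degree P. fact n * coeff P n * fps_nth (h * fps_exp x) n)"
  by (subst poly_divided_power_sum)
    (simp add: umbral_op_sum umbral_op_smult poly_sum poly_umbral_op_divided_power
      del: smult_monom)

text \<open>By linearity divided powers suffice; there both sides evaluate to the coefficient of
  \<open>t^n\<close> in \<open>g h e^(x t)\<close>.\<close>

lemma umbral_op_mult: "umbral_op (g * h) P = umbral_op g (umbral_op h P)"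
proof -
  have *: "umbral_op (g * h) (monom (1 / fact n) n) = umbral_op g (umbral_op h (monom (1 / fact n) n))"
    for n
  proof (rule poly_eq_poly_eq_iff[THEN iffD1], rule ext)
    fix x
    have "poly (umbral_op g (umbral_op h (monom (1 / fact n) n))) x =
        (\<Sum>j\<le>n. fps_nth h j * fps_nth (g * fps_exp x) (n - j))"
      by (simp only: umbral_op_divided_power[of h] umbral_op_sum umbral_op_smult poly_sum
          poly_smult poly_umbral_op_divided_power)
    also have "\<dots> = fps_nth (h * (g * fps_exp x)) n"
      by (simp add: fps_mult_nth[of h] atLeast0AtMost)
    finally show "poly (umbral_op (g * h) (monom (1 / fact n) n)) x =
        poly (umbral_op g (umbral_op h (monom (1 / fact n) n))) x"
      by (simp add: poly_umbral_op_divided_power mult_ac)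
  qed
  show ?thesis
    by (subst (1 2) poly_divided_power_sum[of P])
      (simp only: umbral_op_sum umbral_op_smult *)
qed

lemma umbral_op_one: "umbral_op 1 P = P"
proof -
  have "umbral_op 1 P = (\<Sum>j\<le>degree P. if j = 0 then P else 0)"
    unfolding umbral_op_def by (intro sum.cong) auto
  then show ?thesis by simp
qed

lemma umbral_op_add_series: "umbral_op (g + h) P = umbral_op g P + umbral_op h P"
  by (simp add: umbral_op_def smult_add_left sum.distrib)

lemma umbral_op_const: "umbral_op (fps_const c) P = smult c P"
proof -
  have "umbral_op (fps_const c) P = (\<Sum>j\<le>degree P. if j = 0 then smult c P else 0)"
    unfolding umbral_op_def by (intro sum.cong) auto
  then show ?thesis by simp
qed

text \<open>Taylor's formula, in the form \<open>e^(x t) e^(y t) = e^((x + y) t)\<close>.\<close>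

lemma poly_umbral_op_exp: "poly (umbral_op (fps_exp y) P) x = poly P (x + y)"
proof -
  have "poly (umbral_op (fps_exp y) P) x = (\<Sum>n\<le>degree P. fact n * coeff P n * ((x + y) ^ n / fact n))"
    by (simp add: poly_umbral_op fps_exp_add_mult[symmetric] add.commute)
  then show ?thesis by (simp add: poly_altdef)
qed

section \<open>Weighted q-Euler polynomials and Appell sequences\<close>

lemma q_euler_poly_conv_umbral_op:
  "q_euler_poly q \<zeta> k n =
     umbral_op ((fps_const (1 + q) / (fps_const (\<zeta> * q) * fps_exp 1 + 1)) ^ k) (monom 1 n)"
proof -
  let ?h = "(fps_const (1 + q) / (fps_const (\<zeta> * q) * fps_exp 1 + 1)) ^ k"
  \<comment> \<open>The coefficient of \<open>t^n\<close> in the generating function is, as a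
    polynomial in \<open>x\<close>, the divided power expansion of the operator.\<close>
  have "q_euler_poly q \<zeta> k n = smult (fact n) (umbral_op ?h (monom (1 / fact n) n))"
    by (simp add: q_euler_poly_def umbral_op_divided_power fps_mult_nth fps_poly_const_def
        exp_xt_def atLeast0AtMost mult.commute[of q])
  also have "\<dots> = umbral_op ?h (monom 1 n)"
    by (simp add: umbral_op_smult[symmetric] smult_monom)
  finally show ?thesis .
qed

text \<open>Composing operators cancels \<open>h\<close> against \<open>g\<close>, so that only
  \<open>t^j\<close> acting on \<open>x^n\<close>, evaluated at \<open>0\<close>, remains.\<close>

lemma appell_seq_umbral_op:
  assumes "h * g = 1"
  shows "appell_seq g (\<lambda>n. umbral_op h (monom 1 n))"
  unfolding appell_seq_def sheffer_seq_def
proof (intro conjI allI)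
  have "fps_nth h 0 * fps_nth g 0 = 1"
    using arg_cong[OF assms, of "\<lambda>f. fps_nth f 0"] by simp
  then have "fps_nth g 0 \<noteq> 0" and h0: "fps_nth h 0 \<noteq> 0" by auto
  then show "fps_nth g 0 \<noteq> 0" by simp
  show "degree (umbral_op h (monom 1 n)) = n" for n
    by (simp add: degree_umbral_op[OF h0] degree_monom_eq)
  fix n j :: nat
  have "umbral_functional (g * fps_X ^ j) (umbral_op h (monom 1 n)) =
      poly (umbral_op (fps_X ^ j * (h * g)) (monom 1 n)) 0"
    by (simp add: umbral_functional_conv_op umbral_op_mult[symmetric] mult_ac)
  also have "\<dots> = poly (umbral_op (fps_X ^ j * (h * g)) (smult (fact n) (monom (1 / fact n) n))) 0"
    by (simp add: smult_monom)
  also have "\<dots> = fact n * fps_nth (fps_X ^ j) n"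
    unfolding umbral_op_smult poly_smult poly_umbral_op_divided_power by (simp add: assms)
  finally show "umbral_functional (g * fps_X ^ j) (umbral_op h (monom 1 n)) =
      (if n = j then fact n else 0)"
    by simp
qed simp_all


section \<open>Non-archimedean limits\<close>

context padic_complex
begin

lemma nrm_of_int_le_1: "nrm (of_int m) \<le> 1"
proof (cases "m = 0")
  case True
  then show ?thesis using nrm_eq_0[of 0] by simp
next
  case False
  have "real p ^ multiplicity (int p) m \<ge> 1"
    using prime_gt_0_nat[OF prime_p] by simp
  then show ?thesis using nrm_of_int[OF False] using prime_gt_0_nat[OF prime_p] by simp
qed

lemma nrm_1: "nrm 1 = 1"
  using nrm_of_int[of 1] by simp

lemma nrm_0: "nrm 0 = 0"
  by (simp add: nrm_eq_0)

lemma nrm_minus: "nrm (- x) = nrm x"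
proof -
  have "nrm (- 1) = 1"
    using nrm_of_int[of "-1"] by simp
  then show ?thesis using nrm_mult[of "-1" x] by simp
qed

lemma nrm_minus_commute: "nrm (x - y) = nrm (y - x)"
  using nrm_minus[of "x - y"] by simp

lemma nrm_power: "nrm (x ^ n) = nrm x ^ n"
  by (induction n) (simp_all add: nrm_1 nrm_mult)

lemma nrm_divide: "y \<noteq> 0 \<Longrightarrow> nrm (x / y) = nrm x / nrm y"
  using nrm_mult[of "x / y" y] by (simp add: nrm_eq_0)

lemma nrm_triangle: "nrm (x + y) \<le> nrm x + nrm y"
  using nrm_ultra[of x y] nrm_nonneg[of x] nrm_nonneg[of y] by linarith

text \<open>By the ultrametric inequality the bound does not grow with the number of terms;
  \<open>0 \<le> B\<close> covers sums that are zero by convention.\<close>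

lemma nrm_sum_le:
  assumes "\<And>i. i \<in> A \<Longrightarrow> nrm (f i) \<le> B" and "0 \<le> B"
  shows "nrm (sum f A) \<le> B"
  using assms
proof (induction A rule: infinite_finite_induct)
  case (insert x A)
  then show ?case using nrm_ultra[of "f x" "sum f A"] by fastforce
qed (simp_all add: nrm_0)

lemma nrm_of_int_dvd:
  assumes "int p ^ n dvd m"
  shows "nrm (of_int m) \<le> 1 / real p ^ n"
proof -
  obtain c where "m = int p ^ n * c" using assms by blast
  then have "nrm (of_int m) = nrm (of_int (int p)) ^ n * nrm (of_int c)"
    by (simp add: nrm_mult nrm_power)
  also have "nrm (of_int (int p)) = 1 / real p"
    using nrm_of_int[of "int p"] prime_p prime_gt_1_nat[OF prime_p]
    by (simp add: multiplicity_self)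
  also have "(1 / real p) ^ n * nrm (of_int c) \<le> (1 / real p) ^ n * 1"
    by (intro mult_left_mono nrm_of_int_le_1) simp
  finally show ?thesis by (simp add: power_one_over)
qed

lemma dvd_if_nrm_of_int:
  assumes "nrm (of_int m) \<le> 1 / real p ^ n"
  shows "int p ^ n dvd m"
proof (cases "m = 0")
  case False
  have p: "1 < real p" using prime_gt_1_nat[OF prime_p] by simp
  have "1 / real p ^ multiplicity (int p) m \<le> 1 / real p ^ n"
    using assms nrm_of_int[OF False] by simp
  then have "real p ^ n \<le> real p ^ multiplicity (int p) m"
    using p by (simp add: field_simps)
  then have "n \<le> multiplicity (int p) m"
    using p by simp
  then show ?thesis by (rule multiplicity_dvd')
qed simp

lemma nrm_of_int_not_dvd: "\<not> int p dvd m \<Longrightarrow> nrm (of_int m) = 1"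
  using nrm_of_int[of m] by (auto simp: not_dvd_imp_multiplicity_0)

lemma inverse_p_power_tendsto: "(\<lambda>n. 1 / real p ^ n) \<longlonglongrightarrow> 0"
  using prime_gt_1_nat[OF prime_p] LIMSEQ_inverse_realpow_zero[of "real p"]
  by (simp add: inverse_eq_divide)

lemma nrm_lim_squeeze:
  assumes "\<And>n. nrm (X n - L) \<le> b n" and "b \<longlonglongrightarrow> 0"
  shows "nrm_lim nrm X L"
  unfolding nrm_lim_def
  by (rule tendsto_sandwich[OF _ _ tendsto_const assms(2)]) (simp_all add: nrm_nonneg assms(1))

lemma nrm_lim_const: "nrm_lim nrm (\<lambda>_. c) c"
  by (simp add: nrm_lim_def nrm_0)

lemma nrm_lim_add:
  assumes "nrm_lim nrm X L" and "nrm_lim nrm Y M"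
  shows "nrm_lim nrm (\<lambda>n. X n + Y n) (L + M)"
proof (rule nrm_lim_squeeze)
  show "nrm (X n + Y n - (L + M)) \<le> nrm (X n - L) + nrm (Y n - M)" for n
    using nrm_triangle[of "X n - L" "Y n - M"] by (simp add: algebra_simps)
  show "(\<lambda>n. nrm (X n - L) + nrm (Y n - M)) \<longlonglongrightarrow> 0"
    using tendsto_add[OF assms[unfolded nrm_lim_def]] by simp
qed

lemma nrm_lim_mult:
  assumes "nrm_lim nrm X L" and "nrm_lim nrm Y M"
  shows "nrm_lim nrm (\<lambda>n. X n * Y n) (L * M)"
proof (rule nrm_lim_squeeze)
  let ?b = "\<lambda>n. nrm (X n - L) * nrm (Y n - M) + (nrm L * nrm (Y n - M) + nrm (X n - L) * nrm M)"
  show "nrm (X n * Y n - L * M) \<le> ?b n" for n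
  proof -
    have "X n * Y n - L * M = (X n - L) * (Y n - M) + (L * (Y n - M) + (X n - L) * M)"
      by (simp add: algebra_simps)
    then show ?thesis
      using nrm_triangle[of "(X n - L) * (Y n - M)" "L * (Y n - M) + (X n - L) * M"]
        nrm_triangle[of "L * (Y n - M)" "(X n - L) * M"] by (simp add: nrm_mult)
  qed
  have "?b \<longlonglongrightarrow> 0 * 0 + (nrm L * 0 + 0 * nrm M)"
    using assms unfolding nrm_lim_def by (intro tendsto_intros)
  then show "?b \<longlonglongrightarrow> 0" by simp
qed

lemma nrm_lim_minus:
  assumes "nrm_lim nrm X L"
  shows "nrm_lim nrm (\<lambda>n. - X n) (- L)"
  using nrm_lim_mult[OF nrm_lim_const[of "-1"] assms] by simp

lemma nrm_lim_diff:
  assumes "nrm_lim nrm X L" and "nrm_lim nrm Y M"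
  shows "nrm_lim nrm (\<lambda>n. X n - Y n) (L - M)"
  using nrm_lim_add[OF assms(1) nrm_lim_minus[OF assms(2)]] by simp

lemma nrm_lim_poly:
  assumes "nrm_lim nrm X L"
  shows "nrm_lim nrm (\<lambda>n. poly P (X n)) (poly P L)"
  by (induction P) (simp_all add: nrm_lim_const nrm_lim_add nrm_lim_mult assms)

text \<open>This justifies the definite descriptions in \<open>fermionic_integral\<close> and
  \<open>padic_pow\<close>.\<close>

lemma nrm_lim_unique:
  assumes "nrm_lim nrm X L" and "nrm_lim nrm X M"
  shows "L = M"
proof -
  have "nrm_lim nrm (\<lambda>_. 0) (L - M)"
    using nrm_lim_diff[OF assms] by simp
  then have "(\<lambda>_. nrm (L - M)) \<longlonglongrightarrow> 0"
    by (simp add: nrm_lim_def nrm_minus nrm_minus_commute)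
  then show ?thesis
    by (simp add: LIMSEQ_const_iff nrm_eq_0)
qed

lemma fermionic_integral_eqI: "nrm_lim nrm (fermionic_sum p q f) I \<Longrightarrow> fermionic_integral p nrm q f = I"
  unfolding fermionic_integral_def by (blast intro: nrm_lim_unique)


section \<open>Powers with p-adic integer exponents\<close>

lemma nrm_one_unit:
  assumes "nrm (w - 1) < 1"
  shows "nrm w = 1"
proof -
  have "nrm w \<le> max (nrm (w - 1)) 1" and "1 \<le> max (nrm (w - 1)) (nrm w)"
    using nrm_ultra[of "w - 1" 1] nrm_ultra[of "1 - w" w] by (auto simp: nrm_1 nrm_minus_commute)
  then show ?thesis using assms by linarith
qed

text \<open>The cofactor of \<open>w - 1\<close> is a geometric sum of elements of norm 1, hence of
  norm at most 1.\<close>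

lemma nrm_power_diff_le:
  assumes "nrm (w - 1) < 1"
  shows "nrm (w ^ m - 1) \<le> nrm (w - 1)"
proof -
  have "nrm (\<Sum>i<m. w ^ i) \<le> 1"
    by (intro nrm_sum_le) (simp_all add: nrm_power nrm_one_unit[OF assms])
  then have "nrm (w - 1) * nrm (\<Sum>i<m. w ^ i) \<le> nrm (w - 1)"
    using nrm_nonneg[of "w - 1"] by (simp add: mult_left_le)
  then show ?thesis by (simp add: power_diff_1_eq nrm_mult)
qed

text \<open>Since \<open>w\<close> is close to \<open>1\<close>, the geometric sum \<open>1 + w + \<dots> + w\<^sup>p\<^sup>-\<^sup>1\<close> is close to \<open>p\<close>.\<close>

lemma nrm_p_power_diff_le:
  assumes "nrm (w - 1) < 1"
  shows "nrm (w ^ p - 1) \<le> nrm (w - 1) * max (nrm (w - 1)) (1 / real p)"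
proof -
  have "(\<Sum>i<p. w ^ i) = (\<Sum>i<p. w ^ i - 1) + of_int (int p)"
    by (simp add: sum_subtractf)
  moreover have "nrm (\<Sum>i<p. w ^ i - 1) \<le> nrm (w - 1)"
    by (intro nrm_sum_le nrm_power_diff_le assms nrm_nonneg)
  moreover have "nrm (of_int (int p)) \<le> 1 / real p"
    using nrm_of_int_dvd[of 1 "int p"] by simp
  ultimately have "nrm (\<Sum>i<p. w ^ i) \<le> max (nrm (w - 1)) (1 / real p)"
    using nrm_ultra[of "\<Sum>i<p. w ^ i - 1" "of_int (int p)"] by auto
  then show ?thesis
    by (simp add: power_diff_1_eq nrm_mult mult_left_mono nrm_nonneg)
qed

text \<open>The distance to 1 never exceeds its initial value, so each further \<open>p\<close>-th
  power shrinks it by the fixed factor \<open>\<rho>\<close>: the decay is geometric.\<close>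

lemma p_power_lim:
  assumes "nrm (w - 1) < 1"
  shows "nrm_lim nrm (\<lambda>n. w ^ p ^ n) 1"
proof (rule nrm_lim_squeeze)
  define \<rho> where "\<rho> = max (nrm (w - 1)) (1 / real p)"
  have \<rho>: "0 \<le> \<rho>" "\<rho> < 1"
    using assms prime_gt_1_nat[OF prime_p] nrm_nonneg[of "w - 1"] by (auto simp: \<rho>_def)
  show "nrm (w ^ p ^ n - 1) \<le> \<rho> ^ n" for n
  proof (induction n)
    case 0
    then show ?case using assms by simp
  next
    case (Suc n)
    let ?u = "w ^ p ^ n"
    have le: "nrm (?u - 1) \<le> nrm (w - 1)" by (rule nrm_power_diff_le[OF assms])
    have "nrm (?u ^ p - 1) \<le> nrm (?u - 1) * max (nrm (?u - 1)) (1 / real p)"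
      using le assms by (intro nrm_p_power_diff_le) simp
    also have "\<dots> \<le> \<rho> ^ n * \<rho>"
      using le \<rho> by (intro mult_mono Suc) (auto simp: \<rho>_def nrm_nonneg le_max_iff_disj)
    finally show ?case by (simp add: power_mult[symmetric] mult.commute)
  qed
  show "(\<lambda>n. \<rho> ^ n) \<longlonglongrightarrow> 0" using \<rho> by (simp add: LIMSEQ_realpow_zero)
qed

text \<open>Close exponents differ by a multiple of \<open>p ^ N\<close>. Factoring out a power of
  norm 1 leaves a power of \<open>w ^ p ^ N\<close>, minus 1, which is small uniformly in the
  exponents.\<close>

lemma power_uniformly_continuous:
  assumes "nrm (w - 1) < 1" and "0 < e"
  obtains d where "0 < d"
    and "\<And>a b. nrm (of_nat a - of_nat b) < d \<Longrightarrow> nrm (w ^ a - w ^ b) < e"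
proof -
  obtain N where N: "nrm (w ^ p ^ N - 1) < e"
    using order_tendstoD(2)[OF p_power_lim[OF assms(1), unfolded nrm_lim_def] assms(2)]
    by (auto simp: eventually_sequentially)
  have *: "nrm (w ^ a - w ^ b) < e"
    if le: "b \<le> a" and near: "nrm (of_nat a - of_nat b) < 1 / real p ^ N" for a b :: nat
  proof -
    have "int p ^ N dvd int (a - b)"
      using le near by (intro dvd_if_nrm_of_int) (simp add: of_nat_diff)
    then have "p ^ N dvd a - b" by (metis of_nat_dvd_iff of_nat_power)
    then obtain c where c: "a = b + p ^ N * c" using le by (metis dvdE le_add_diff_inverse)
    have "w ^ a - w ^ b = w ^ b * ((w ^ p ^ N) ^ c - 1)"
      by (simp add: c power_add power_mult right_diff_distrib)
    then have "nrm (w ^ a - w ^ b) = nrm ((w ^ p ^ N) ^ c - 1)"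
      by (simp add: nrm_mult nrm_power nrm_one_unit[OF assms(1)])
    also have "\<dots> \<le> nrm (w ^ p ^ N - 1)"
      using nrm_power_diff_le[OF assms(1), of "p ^ N"] assms(1) by (intro nrm_power_diff_le) simp
    finally show ?thesis using N by simp
  qed
  show ?thesis
  proof (rule that)
    show "0 < 1 / real p ^ N" using prime_gt_0_nat[OF prime_p] by simp
    show "nrm (w ^ a - w ^ b) < e" if "nrm (of_nat a - of_nat b) < 1 / real p ^ N" for a b
      using *[of b a] *[of a b] that by (metis linear nrm_minus_commute)
  qed
qed

section \<open>Density of the natural numbers in the p-adic integers\<close>

lemma rat_approx_nat:
  assumes "nrm (of_rat r) \<le> 1"
  obtains m :: nat where "nrm (of_nat m - of_rat r) \<le> 1 / real p ^ n"
proof -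
  obtain a b where ab: "quotient_of r = (a, b)" by (metis surj_pair)
  have b: "b > 0" and cop: "coprime a b" and r: "of_rat r = (of_int a / of_int b :: 'a)"
    using quotient_of_denom_pos[OF ab] quotient_of_coprime[OF ab] quotient_of_div[OF ab]
    by (simp_all add: of_rat_divide)
  have "\<not> int p dvd b"
  proof
    assume dvd: "int p dvd b"
    then have "\<not> int p dvd a"
      using cop prime_p by (metis coprime_common_divisor not_prime_unit prime_int_nat_transfer nat_int of_nat_0_le_iff)
    then have "nrm (of_int a) = 1" by (rule nrm_of_int_not_dvd)
    moreover have "nrm (of_int b) < 1"
      using nrm_of_int_dvd[of 1 b] dvd prime_gt_1_nat[OF prime_p]
      by (auto intro: le_less_trans)
    moreover have "0 < nrm (of_int b)"
      using b nrm_nonneg[of "of_int b"] nrm_eq_0[of "of_int b"] by simp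
    ultimately show False
      using assms b by (simp add: r nrm_divide)
  qed
  then have nb: "nrm (of_int b) = 1" and "coprime b (int p ^ n)"
    using prime_p prime_imp_coprime[of "int p" b]
    by (auto simp: nrm_of_int_not_dvd coprime_commute)
  \<comment> \<open>Bezout makes \<open>c\<close> an inverse of \<open>b\<close> modulo
    \<open>p ^ n\<close>, so \<open>a * c\<close> represents \<open>a / b\<close> there.\<close>
  then obtain c d where cd: "c * b + d * int p ^ n = 1"
    by (metis bezout_int coprime_iff_gcd_eq_1)
  define m where "m = a * c mod int p ^ n"
  have m: "0 \<le> m" using prime_gt_0_nat[OF prime_p] by (simp add: m_def)
  have "b * m - a = b * (a * c) - a - b * int p ^ n * (a * c div int p ^ n)"
    by (simp add: m_def minus_div_mult_eq_mod[symmetric] algebra_simps)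
  also have "b * (a * c) - a = a * (c * b - 1)" by (simp add: algebra_simps)
  also have "c * b - 1 = - (d * int p ^ n)" using cd by simp
  finally have "int p ^ n dvd b * m - a" by simp
  then have "nrm (of_int (b * m - a)) \<le> 1 / real p ^ n" by (rule nrm_of_int_dvd)
  \<comment> \<open>Dividing by \<open>b\<close>, of norm 1, preserves the estimate.\<close>
  moreover have "of_nat (nat m) - of_rat r = (of_int (b * m - a) / of_int b :: 'a)"
    using b m by (simp add: r of_nat_nat field_simps)
  ultimately show ?thesis
    using that[of "nat m"] b nb by (simp add: nrm_divide)
qed

text \<open>Without such a sequence the condition defining \<open>padic_pow\<close> would hold
  vacuously for every value.\<close>

lemma padic_ints_nat_seq:
  assumes "z \<in> padic_ints nrm"
  obtains m :: "nat \<Rightarrow> nat" where "nrm_lim nrm (\<lambda>n. of_nat (m n)) z"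
proof -
  have z1: "nrm z \<le> 1" using assms by (simp add: padic_ints_def)
  obtain r where r: "nrm_lim nrm (\<lambda>n. of_rat (r n)) z"
    using assms by (auto simp: padic_ints_def padic_rats_def)
  have "\<exists>m. nrm (of_nat m - z) \<le> 1 / real p ^ n" for n
  proof -
    have pos: "0 < 1 / real p ^ n" and le1: "1 / real p ^ n \<le> 1"
      using prime_gt_0_nat[OF prime_p] by (simp_all add: Suc_leI)
    obtain i where i: "nrm (of_rat (r i) - z) < 1 / real p ^ n"
      using order_tendstoD(2)[OF r[unfolded nrm_lim_def] pos]
      by (auto simp: eventually_sequentially)
    have "nrm (of_rat (r i)) \<le> 1"
      using nrm_ultra[of "of_rat (r i) - z" z] i le1 z1 by simp
    then obtain m :: nat where "nrm (of_nat m - of_rat (r i)) \<le> 1 / real p ^ n"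
      by (rule rat_approx_nat)
    then have "nrm (of_nat m - z) \<le> 1 / real p ^ n"
      using nrm_ultra[of "of_nat m - of_rat (r i)" "of_rat (r i) - z"] i by simp
    then show ?thesis by blast
  qed
  then obtain m where "\<And>n. nrm (of_nat (m n) - z) \<le> 1 / real p ^ n" by metis
  then show ?thesis by (intro that nrm_lim_squeeze[OF _ inverse_p_power_tendsto])
qed

lemma padic_ints_add: "a \<in> padic_ints nrm \<Longrightarrow> b \<in> padic_ints nrm \<Longrightarrow> a + b \<in> padic_ints nrm"
proof -
  assume a: "a \<in> padic_ints nrm" and b: "b \<in> padic_ints nrm"
  obtain r s where "nrm_lim nrm (\<lambda>n. of_rat (r n)) a" "nrm_lim nrm (\<lambda>n. of_rat (s n)) b"
    using a b by (auto simp: padic_ints_def padic_rats_def)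
  then have "nrm_lim nrm (\<lambda>n. of_rat (r n + s n)) (a + b)"
    by (simp add: of_rat_add nrm_lim_add)
  then have "a + b \<in> padic_rats nrm"
    unfolding padic_rats_def by (intro CollectI exI[of _ "\<lambda>n. r n + s n"])
  then show ?thesis
    using a b nrm_ultra[of a b] by (auto simp: padic_ints_def)
qed

lemma of_nat_padic_ints: "of_nat m \<in> padic_ints nrm"
proof -
  have "nrm_lim nrm (\<lambda>_. of_rat (of_nat m)) (of_nat m)"
    using nrm_lim_const by simp
  then have "of_nat m \<in> padic_rats nrm"
    unfolding padic_rats_def by (intro CollectI exI[of _ "\<lambda>_. of_nat m"])
  then show ?thesis
    using nrm_of_int_le_1[of "int m"] by (simp add: padic_ints_def)
qed

text \<open>Uniform continuity makes powers along one approximating sequence Cauchy, and forces all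
  other such sequences to the same limit.\<close>

lemma padic_pow_lim:
  assumes w: "nrm (1 - w) < 1" and z: "z \<in> padic_ints nrm"
    and m: "nrm_lim nrm (\<lambda>n. of_nat (m n)) z"
  shows "nrm_lim nrm (\<lambda>n. w ^ m n) (padic_pow nrm w z)"
proof -
  have w': "nrm (w - 1) < 1" using w by (simp add: nrm_minus_commute)
  obtain m0 where m0: "nrm_lim nrm (\<lambda>n. of_nat (m0 n)) z"
    using padic_ints_nat_seq[OF z] by blast
  \<comment> \<open>The two indices vary independently: equal sequences give the Cauchy property,
    different ones the independence of the choice.\<close>
  have near: "\<exists>N. \<forall>i\<ge>N. \<forall>j\<ge>N. nrm (w ^ m1 i - w ^ m2 j) < e"
    if lim: "nrm_lim nrm (\<lambda>n. of_nat (m1 n)) z" "nrm_lim nrm (\<lambda>n. of_nat (m2 n)) z" and "0 < e"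
    for m1 m2 :: "nat \<Rightarrow> nat" and e
  proof -
    obtain d where d: "0 < d"
      "\<And>a b. nrm (of_nat a - of_nat b) < d \<Longrightarrow> nrm (w ^ a - w ^ b) < e"
      using power_uniformly_continuous[OF w' \<open>0 < e\<close>] by blast
    obtain N1 N2 where N: "\<And>i. i \<ge> N1 \<Longrightarrow> nrm (of_nat (m1 i) - z) < d"
      "\<And>i. i \<ge> N2 \<Longrightarrow> nrm (of_nat (m2 i) - z) < d"
      using order_tendstoD(2)[OF lim(1)[unfolded nrm_lim_def] d(1)]
        order_tendstoD(2)[OF lim(2)[unfolded nrm_lim_def] d(1)]
      by (auto simp: eventually_sequentially)
    have "nrm (w ^ m1 i - w ^ m2 j) < e" if "max N1 N2 \<le> i" "max N1 N2 \<le> j" for i j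
    proof (rule d(2))
      show "nrm (of_nat (m1 i) - of_nat (m2 j)) < d"
        using nrm_ultra[of "of_nat (m1 i) - z" "z - of_nat (m2 j)"] N(1)[of i] N(2)[of j] that
        by (simp add: nrm_minus_commute[of z])
    qed
    then show ?thesis by blast
  qed
  have "nrm_Cauchy nrm (\<lambda>n. w ^ m0 n)"
    unfolding nrm_Cauchy_def using near[OF m0 m0] by blast
  then obtain y where y: "nrm_lim nrm (\<lambda>n. w ^ m0 n) y" using complete by blast
  have lim: "nrm_lim nrm (\<lambda>n. w ^ m1 n) y" if "nrm_lim nrm (\<lambda>n. of_nat (m1 n)) z" for m1
  proof -
    have "nrm_lim nrm (\<lambda>n. w ^ m1 n - w ^ m0 n) 0"
      unfolding nrm_lim_def
      by (rule LIMSEQ_I) (use near[OF that m0] in \<open>fastforce simp: nrm_nonneg\<close>)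
    from nrm_lim_add[OF this y] show ?thesis by simp
  qed
  \<comment> \<open>The sequence \<open>m0\<close> is the witness that pins down the value.\<close>
  have "padic_pow nrm w z = y"
    unfolding padic_pow_def
    by (rule the_equality) (use lim m0 nrm_lim_unique y in blast)+
  then show ?thesis using lim[OF m] by simp
qed

text \<open>Shift an approximating sequence of \<open>z\<close> by \<open>a\<close>. Fermionic sums
  sample at natural numbers, so this extracts \<open>w ^ a\<close> from their terms.\<close>

lemma padic_pow_of_nat_add:
  assumes "nrm (1 - w) < 1" and "z \<in> padic_ints nrm"
  shows "padic_pow nrm w (of_nat a + z) = w ^ a * padic_pow nrm w z"
proof -
  obtain m where m: "nrm_lim nrm (\<lambda>n. of_nat (m n)) z"
    using padic_ints_nat_seq[OF assms(2)] by blast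
  then have "nrm_lim nrm (\<lambda>n. of_nat (a + m n)) (of_nat a + z)"
    by (simp add: nrm_lim_add nrm_lim_const)
  then have "nrm_lim nrm (\<lambda>n. w ^ (a + m n)) (padic_pow nrm w (of_nat a + z))"
    by (intro padic_pow_lim padic_ints_add of_nat_padic_ints assms)
  moreover have "nrm_lim nrm (\<lambda>n. w ^ (a + m n)) (w ^ a * padic_pow nrm w z)"
    using nrm_lim_mult[OF nrm_lim_const padic_pow_lim[OF assms m]] by (simp add: power_add)
  ultimately show ?thesis by (rule nrm_lim_unique)
qed

lemma padic_pow_0:
  assumes "nrm (1 - w) < 1"
  shows "padic_pow nrm w 0 = 1"
proof -
  have "nrm_lim nrm (\<lambda>_. 1) (padic_pow nrm w 0)"
    using padic_pow_lim[OF assms of_nat_padic_ints[of 0], of "\<lambda>_. 0"] nrm_lim_const[of 0] by simp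
  then show ?thesis using nrm_lim_const by (rule nrm_lim_unique)
qed

end

section \<open>Fermionic integrals of exponential polynomials\<close>

text \<open>The difference equation turns each term, multiplied by \<open>c\<close>, into a
  difference of consecutive values of \<open>(- w) ^ i * poly Q (of_nat i + x)\<close>.\<close>

lemma alternating_power_sum:
  fixes w :: "'a::comm_ring_1"
  assumes "\<And>y. w * poly Q (y + 1) + poly Q y = c * poly P y"
  shows "c * (\<Sum>i<N. (- w) ^ i * poly P (of_nat i + x)) = poly Q x - (- w) ^ N * poly Q (of_nat N + x)"
proof (induction N)
  case (Suc N)
  have "c * poly P (of_nat N + x) = w * poly Q (of_nat (Suc N) + x) + poly Q (of_nat N + x)"
    using assms[of "of_nat N + x"] by (simp add: add_ac)
  then have "c * ((- w) ^ N * poly P (of_nat N + x)) =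
      (- w) ^ N * (w * poly Q (of_nat (Suc N) + x) + poly Q (of_nat N + x))"
    by (metis mult.left_commute)
  then show ?case
    using Suc by (simp add: algebra_simps)
qed simp

context padic_complex
begin

text \<open>For odd \<open>p\<close> the norm of \<open>2 = (1 + w) + (1 - w)\<close> is 1 and the
  second summand is smaller. This controls every denominator of the form
  \<open>1 + w\<close>.\<close>

lemma nrm_one_plus_unit:
  assumes "odd p" and "nrm (w - 1) < 1"
  shows "nrm (1 + w) = 1"
proof -
  have "\<not> int p dvd 2"
    using assms(1) prime_ge_2_nat[OF prime_p] by (auto dest: zdvd_imp_le)
  then have "nrm 2 = 1" using nrm_of_int_not_dvd[of 2] by simp
  moreover have "nrm 2 \<le> max (nrm (1 + w)) (nrm (w - 1))"
    using nrm_ultra[of "1 + w" "1 - w"] by (simp add: nrm_minus_commute)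
  moreover have "nrm (1 + w) \<le> 1"
    using nrm_ultra[of 1 w] by (simp add: nrm_1 nrm_one_unit[OF assms(2)])
  ultimately show ?thesis using assms(2) by linarith
qed

lemma nrm_mult_one_unit:
  assumes "nrm (v - 1) < 1" and "nrm (w - 1) < 1"
  shows "nrm (v * w - 1) < 1"
proof -
  have "v * w - 1 = v * (w - 1) + (v - 1)" by (simp add: algebra_simps)
  then have "nrm (v * w - 1) \<le> max (nrm (v * (w - 1))) (nrm (v - 1))"
    by (simp only: nrm_ultra)
  then have "nrm (v * w - 1) \<le> max (nrm (w - 1)) (nrm (v - 1))"
    by (simp add: nrm_mult nrm_one_unit[OF assms(1)])
  then show ?thesis using assms by linarith
qed

lemma nrm_lim_p_power: "nrm_lim nrm (\<lambda>n. of_nat (p ^ n)) 0"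
proof (rule nrm_lim_squeeze)
  show "nrm (of_nat (p ^ n) - 0) \<le> 1 / real p ^ n" for n
    using nrm_of_int_dvd[of n "int p ^ n"] by simp
qed (rule inverse_p_power_tendsto)

text \<open>The integrand is prescribed at natural numbers only, so that \<open>f\<close> may be an
  inner integral whose closed form is known just on p-adic integers.\<close>

lemma fermionic_sum_exp_poly_lim:
  assumes "odd p" and q: "nrm (q - 1) < 1" and \<zeta>: "nrm (1 - \<zeta>) < 1"
    and f: "\<And>m. f (of_nat m) = c * \<zeta> ^ m * poly P (of_nat m + x)"
  shows "nrm_lim nrm (fermionic_sum p q f)
     (c * poly (umbral_op (fps_const (1 + q) / (fps_const (\<zeta> * q) * fps_exp 1 + 1)) P) x)"
proof -
  define w where "w = \<zeta> * q"
  define g where "g = fps_const w * fps_exp 1 + 1"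
  define Q where "Q = umbral_op (fps_const (1 + q) / g) P"
  have w: "nrm (w - 1) < 1"
    unfolding w_def using \<zeta> q by (intro nrm_mult_one_unit) (simp_all add: nrm_minus_commute)
  have q1: "1 + q \<noteq> 0" and w1: "1 + w \<noteq> 0"
    using nrm_one_plus_unit[OF \<open>odd p\<close>] q w nrm_0 by fastforce+
  have "g * (fps_const (1 + q) / g) = fps_const (1 + q)"
    using w1 by (simp add: fps_divide_unit g_def add.commute inverse_mult_eq_1' mult.left_commute)
  then have "umbral_op g Q = smult (1 + q) P"
    unfolding Q_def umbral_op_mult[symmetric] by (simp add: umbral_op_const)
  \<comment> \<open>In \<open>g\<close> the series \<open>e^t\<close> acts as translation by
    1.\<close>
  then have Q: "w * poly Q (y + 1) + poly Q y = (1 + q) * poly P y" for y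
    by (metis g_def poly_add poly_smult poly_umbral_op_exp umbral_op_add_series umbral_op_const
        umbral_op_mult umbral_op_one)
  \<comment> \<open>As \<open>p ^ n\<close> is odd, both \<open>(- w) ^ p ^ n\<close> and
    \<open>(- q) ^ p ^ n\<close> change sign; the factor \<open>1 + q\<close> cancels against the
    bracket.\<close>
  have sum_eq: "fermionic_sum p q f n =
      c * (poly Q x + w ^ p ^ n * poly Q (of_nat (p ^ n) + x)) / (1 + q ^ p ^ n)" for n
  proof -
    have odd: "odd (p ^ n)" using \<open>odd p\<close> by simp
    have "(\<Sum>\<xi><p ^ n. f (of_nat \<xi>) * (- 1) ^ \<xi> * q ^ \<xi>) =
        c * (\<Sum>\<xi><p ^ n. (- w) ^ \<xi> * poly P (of_nat \<xi> + x))"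
      unfolding sum_distrib_left
      by (intro sum.cong refl) (simp add: f w_def power_mult_distrib power_minus[of "\<zeta> * q"])
    also have "(1 + q) * \<dots> = c * (poly Q x + w ^ p ^ n * poly Q (of_nat (p ^ n) + x))"
      using alternating_power_sum[where N = "p ^ n", OF Q] odd
      by (simp add: mult.left_commute)
    finally show ?thesis
      using odd q1 by (simp add: fermionic_sum_def neg_q_bracket_def mult.commute)
  qed
  \<comment> \<open>Subtracting the limit leaves \<open>c * ?E n\<close> over
    \<open>1 + q ^ p ^ n\<close>, a denominator of norm 1.\<close>
  let ?E = "\<lambda>n. w ^ p ^ n * poly Q (of_nat (p ^ n) + x) - q ^ p ^ n * poly Q x"
  have "nrm (fermionic_sum p q f n - c * poly Q x) \<le> nrm (c * ?E n - 0)" for n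
  proof -
    have "nrm (q ^ p ^ n - 1) < 1"
      using nrm_power_diff_le[OF q, of "p ^ n"] q by simp
    then have "nrm (1 + q ^ p ^ n) = 1" by (rule nrm_one_plus_unit[OF \<open>odd p\<close>])
    moreover from this have "1 + q ^ p ^ n \<noteq> 0" using nrm_0 by fastforce
    moreover from this have "fermionic_sum p q f n - c * poly Q x = c * ?E n / (1 + q ^ p ^ n)"
      unfolding sum_eq by (simp add: field_simps)
    ultimately show ?thesis by (simp add: nrm_divide)
  qed
  moreover have "nrm_lim nrm (\<lambda>n. c * ?E n) 0"
  proof -
    have "nrm_lim nrm (\<lambda>n. c * ?E n) (c * (1 * poly Q (0 + x) - 1 * poly Q x))"
      by (intro nrm_lim_mult nrm_lim_diff nrm_lim_poly nrm_lim_add nrm_lim_const nrm_lim_p_power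
          p_power_lim q w)
    then show ?thesis by simp
  qed
  ultimately have "nrm_lim nrm (fermionic_sum p q f) (c * poly Q x)"
    unfolding nrm_lim_def[of _ "\<lambda>n. c * ?E n"] by (rule nrm_lim_squeeze)
  then show ?thesis by (simp add: Q_def g_def w_def)
qed

text \<open>
  The shift \<open>c\<close> of the exponent, independent of the shift \<open>x\<close> of the polynomial, absorbs the
  outer variable in the induction step.
\<close>

lemma iter_integral_exp_poly:
  assumes "odd p" and q: "nrm (q - 1) < 1" and \<zeta>: "nrm (1 - \<zeta>) < 1" and "c \<in> padic_ints nrm"
  defines "h \<equiv> fps_const (1 + q) / (fps_const (\<zeta> * q) * fps_exp 1 + 1)"
  shows "iter_integrable p nrm q k
      (\<lambda>\<xi>s. padic_pow nrm \<zeta> (sum_list \<xi>s + c) * poly P (sum_list \<xi>s + x)) \<and>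
    iter_integral p nrm q k
      (\<lambda>\<xi>s. padic_pow nrm \<zeta> (sum_list \<xi>s + c) * poly P (sum_list \<xi>s + x)) =
      padic_pow nrm \<zeta> c * poly (umbral_op (h ^ k) P) x"
  using \<open>c \<in> padic_ints nrm\<close>
proof (induction k arbitrary: c x)
  case 0
  then show ?case by (simp add: umbral_op_one)
next
  case (Suc k)
  let ?F = "\<lambda>\<xi>s. padic_pow nrm \<zeta> (sum_list \<xi>s + c) * poly P (sum_list \<xi>s + x)"
  let ?f = "\<lambda>\<xi>. iter_integral p nrm q k (\<lambda>\<xi>s. ?F (\<xi>s @ [\<xi>]))"
  \<comment> \<open>Appending the outer variable adds it to both shifts, and
    \<open>\<xi> + c\<close> is again a p-adic integer.\<close>
  have inner: "iter_integrable p nrm q k (\<lambda>\<xi>s. ?F (\<xi>s @ [\<xi>]))"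
    "?f \<xi> = padic_pow nrm \<zeta> (\<xi> + c) * poly (umbral_op (h ^ k) P) (\<xi> + x)"
    if "\<xi> \<in> padic_ints nrm" for \<xi>
    using Suc.IH[OF padic_ints_add[OF that Suc.prems], of "\<xi> + x"] by (simp_all add: add.assoc)
  have "?f (of_nat m) = padic_pow nrm \<zeta> c * \<zeta> ^ m * poly (umbral_op (h ^ k) P) (of_nat m + x)" for m
    by (subst inner(2)[OF of_nat_padic_ints])
      (simp only: padic_pow_of_nat_add[OF \<zeta> Suc.prems] mult_ac)
  from fermionic_sum_exp_poly_lim[where f = ?f, OF \<open>odd p\<close> q \<zeta> this]
  have "nrm_lim nrm (fermionic_sum p q ?f) (padic_pow nrm \<zeta> c * poly (umbral_op (h ^ Suc k) P) x)"
    by (simp add: h_def umbral_op_mult)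
  moreover from this have "fermionic_integrable p nrm q ?f"
    unfolding fermionic_integrable_def by blast
  ultimately show ?case
    using inner(1) unfolding iter_integral.simps iter_integrable.simps
    by (blast intro: fermionic_integral_eqI)
qed

end

theorem theorem5:
  fixes p :: nat and nrm :: "'a::field_char_0 \<Rightarrow> real" and q \<zeta> :: 'a and k :: nat
  assumes "padic_complex p nrm" and "odd p"
    and "nrm (q - 1) < 1" and "nrm (1 - \<zeta>) < 1"
  shows
    "(\<forall>(P :: 'a poly) x.
        iter_integrable p nrm q k
          (\<lambda>\<xi>s. padic_pow nrm \<zeta> (sum_list \<xi>s) * poly P (sum_list \<xi>s + x)) \<and>
        iter_integral p nrm q k
          (\<lambda>\<xi>s. padic_pow nrm \<zeta> (sum_list \<xi>s) * poly P (sum_list \<xi>s + x)) =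
        poly (umbral_op ((fps_const (1 + q) / (fps_const (\<zeta> * q) * fps_exp 1 + 1)) ^ k) P) x) \<and>
     iter_integrable_fps p nrm q k
       (\<lambda>\<xi>s. fps_const (padic_pow nrm \<zeta> (sum_list \<xi>s)) * fps_exp (sum_list \<xi>s)) \<and>
     (\<forall>n. q_euler_poly q \<zeta> k n =
          umbral_op ((fps_const (1 + q) / (fps_const (\<zeta> * q) * fps_exp 1 + 1)) ^ k) (monom 1 n) \<and>
        umbral_op ((fps_const (1 + q) / (fps_const (\<zeta> * q) * fps_exp 1 + 1)) ^ k) (monom 1 n) =
          umbral_op
            (iter_integral_fps p nrm q k
              (\<lambda>\<xi>s. fps_const (padic_pow nrm \<zeta> (sum_list \<xi>s)) * fps_exp (sum_list \<xi>s)))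
            (monom 1 n)) \<and>
     appell_seq (((fps_const (\<zeta> * q) * fps_exp 1 + 1) / fps_const (1 + q)) ^ k)
       (q_euler_poly q \<zeta> k) \<and>
     sheffer_seq (((fps_const (\<zeta> * q) * fps_exp 1 + 1) / fps_const (1 + q)) ^ k) fps_X
       (q_euler_poly q \<zeta> k)"
proof -
  interpret padic_complex p nrm by fact
  let ?D = "fps_const (\<zeta> * q) * fps_exp 1 + 1" and ?c = "fps_const (1 + q)"
  let ?h = "(?c / ?D) ^ k"
  let ?E = "\<lambda>\<xi>s. fps_const (padic_pow nrm \<zeta> (sum_list \<xi>s)) * fps_exp (sum_list \<xi>s)"
  have zero: "0 \<in> padic_ints nrm" using of_nat_padic_ints[of 0] by simp
  have int: "iter_integrable p nrm q k
        (\<lambda>\<xi>s. padic_pow nrm \<zeta> (sum_list \<xi>s) * poly P (sum_list \<xi>s + x))"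
      "iter_integral p nrm q k
        (\<lambda>\<xi>s. padic_pow nrm \<zeta> (sum_list \<xi>s) * poly P (sum_list \<xi>s + x)) = poly (umbral_op ?h P) x"
    for P x
    using iter_integral_exp_poly[OF assms(2-4) zero, of k P x]
    by (simp_all add: padic_pow_0[OF assms(4)])
  \<comment> \<open>Each coefficient is the integrand for the divided power \<open>x^n / n!\<close>
    at \<open>x = 0\<close>; the explicit \<open>+ 0\<close> matches \<open>int\<close>.\<close>
  have nth: "fps_nth (?E \<xi>s) n =
      padic_pow nrm \<zeta> (sum_list \<xi>s) * poly (monom (1 / fact n) n) (sum_list \<xi>s + 0)" for \<xi>s n
    by (simp add: poly_monom)
  have int_fps: "iter_integrable_fps p nrm q k ?E"
    unfolding iter_integrable_fps_def nth using int(1) by blast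
  \<comment> \<open>Evaluation at \<open>0\<close> reads off the coefficients of \<open>?h\<close>,
    because \<open>e^(0 t) = 1\<close>.\<close>
  have "iter_integral_fps p nrm q k ?E = ?h"
    unfolding iter_integral_fps_def nth int(2) poly_umbral_op_divided_power by (simp add: fps_eq_iff)
  moreover have "appell_seq ((?D / ?c) ^ k) (q_euler_poly q \<zeta> k)"
  proof -
    have "nrm (\<zeta> * q - 1) < 1"
      using assms(3,4) by (intro nrm_mult_one_unit) (simp_all add: nrm_minus_commute)
    then have "1 + \<zeta> * q \<noteq> 0" "1 + q \<noteq> 0"
      using nrm_one_plus_unit[OF assms(2)] assms(3) nrm_0 by fastforce+
    then have D0: "fps_nth ?D 0 \<noteq> 0" and c0: "fps_nth ?c 0 \<noteq> 0" by (simp_all add: add.commute)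
    \<comment> \<open>Both constant terms are nonzero, so the quotients are products with genuine
      inverses.\<close>
    have "(?c / ?D) * (?D / ?c) = (?c * inverse ?c) * (?D * inverse ?D)"
      unfolding fps_divide_unit[OF D0] fps_divide_unit[OF c0] by (simp only: mult_ac)
    also have "\<dots> = 1" by (simp only: inverse_mult_eq_1'[OF D0] inverse_mult_eq_1'[OF c0] mult_1)
    finally have "?h * (?D / ?c) ^ k = 1" by (simp only: power_mult_distrib[symmetric] power_one)
    from appell_seq_umbral_op[OF this] show ?thesis
      by (simp only: q_euler_poly_conv_umbral_op[symmetric])
  qed
  ultimately show ?thesis
    using int int_fps by (simp only: q_euler_poly_conv_umbral_op appell_seq_def simp_thms)
qed

end
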